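(* Let $A$ be a commutative ring with identity. The space $t(\operatorname{Sq} A)$ is canonically homeomorphic to $\operatorname{Spec} A$.
   Context: For an ideal $I$ of $A$, $\sqrt{I}$ denotes its radical. A proper ideal $\mathfrak{q}$ of $A$ is called quasi-prime if whenever $fg\in\mathfrak{q}$ with $f,g\in A$, then $f\in\sqrt{\mathfrak{q}}$ or $g\in\sqrt{\mathfrak{q}}$. The quasi-prime spectrum $\operatorname{Sq} A$ is the set of all quasi-prime ideals of $A$, with the topology having as basis of opens the sets $U_f=\{\mathfrak{q}\in\operatorname{Sq} A: \mathfrak{q}\cap S_f=\emptyset\}$ for $f\in A$, where $S_f=\{f^i : i\ge 0\}=\{1,f,f^2,\dots\}$. $\operatorname{Spec} A$ is the set of prime ideals of $A$ with the Zariski topology. A topological space is irreducible if it is non-empty and cannot be written as the union of two proper closed subsets. For a topological space $X$, $t(X)$ is the topological space whose points are the irreducible and closed subsets of $X$ and whose closed subsets are precisely the sets $t(Y)$ (the set of irreducible and closed subsets of $Y$), where $Y$ ranges over the closed subsets of $X$. *)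

theory Defs
  imports "HOL-Analysis.Abstract_Topology" "HOL-Algebra.Ideal"
begin

text \<open>\<^const>\<open>Abstract_Topology.closure_of\<close> is the topological closure; the setoid
  operation of the same name in HOL-Algebra has a clashing notation.\<close>

no_notation Congruence.eq_closure_of (\<open>closure'_of\<index>\<close>)

definition radical :: "('a, 'b) ring_scheme \<Rightarrow> 'a set \<Rightarrow> 'a set" where
  "radical A I = {a \<in> carrier A. \<exists>n>0. a [^]\<^bsub>A\<^esub> (n::nat) \<in> I}"

definition quasi_prime :: "'a set \<Rightarrow> ('a, 'b) ring_scheme \<Rightarrow> bool" where
  "quasi_prime Q A \<longleftrightarrow> ideal Q A \<and> Q \<noteq> carrier A \<and>
     (\<forall>f\<in>carrier A. \<forall>g\<in>carrier A.
        f \<otimes>\<^bsub>A\<^esub> g \<in> Q \<longrightarrow> f \<in> radical A Q \<or> g \<in> radical A Q)"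


subsection \<open>The quasi-prime spectrum\<close>

definition Sq :: "('a, 'b) ring_scheme \<Rightarrow> 'a set set" where
  "Sq A = {Q. quasi_prime Q A}"

definition powers :: "('a, 'b) ring_scheme \<Rightarrow> 'a \<Rightarrow> 'a set" where
  "powers A f = {f [^]\<^bsub>A\<^esub> i |i. i \<in> (UNIV :: nat set)}"

definition Sq_basic :: "('a, 'b) ring_scheme \<Rightarrow> 'a \<Rightarrow> 'a set set" where
  "Sq_basic A f = {Q \<in> Sq A. Q \<inter> powers A f = {}}"

definition Sq_top :: "('a, 'b) ring_scheme \<Rightarrow> 'a set topology" where
  "Sq_top A = topology (arbitrary union_of (\<lambda>U. \<exists>f\<in>carrier A. U = Sq_basic A f))"

lemma radical_powI:
  assumes "cring A" "ideal Q A" "f \<in> carrier A" "f [^]\<^bsub>A\<^esub> (i::nat) \<in> radical A Q"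
  shows "\<exists>j::nat. f [^]\<^bsub>A\<^esub> j \<in> Q"
proof -
  interpret cring A by fact
  obtain n :: nat where "(f [^]\<^bsub>A\<^esub> i) [^]\<^bsub>A\<^esub> n \<in> Q"
    using assms(4) by (auto simp: radical_def)
  then show ?thesis
    using assms(3) by (metis nat_pow_pow)
qed

lemma Sq_basic_mult:
  assumes "cring A" "f \<in> carrier A" "g \<in> carrier A"
  shows "Sq_basic A f \<inter> Sq_basic A g = Sq_basic A (f \<otimes>\<^bsub>A\<^esub> g)"
proof -
  interpret cring A by fact
  have distrib: "(f \<otimes>\<^bsub>A\<^esub> g) [^]\<^bsub>A\<^esub> i = f [^]\<^bsub>A\<^esub> i \<otimes>\<^bsub>A\<^esub> g [^]\<^bsub>A\<^esub> i" for i :: nat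
    using assms by (simp add: nat_pow_distrib)
  have "(\<exists>i::nat. (f \<otimes>\<^bsub>A\<^esub> g) [^]\<^bsub>A\<^esub> i \<in> Q) \<longleftrightarrow>
        (\<exists>i::nat. f [^]\<^bsub>A\<^esub> i \<in> Q) \<or> (\<exists>i::nat. g [^]\<^bsub>A\<^esub> i \<in> Q)" (is "?L \<longleftrightarrow> ?R")
    if "Q \<in> Sq A" for Q
  proof
    have Q: "ideal Q A" and
      qp: "\<And>f g. \<lbrakk>f \<in> carrier A; g \<in> carrier A; f \<otimes>\<^bsub>A\<^esub> g \<in> Q\<rbrakk>
             \<Longrightarrow> f \<in> radical A Q \<or> g \<in> radical A Q"
      using that by (auto simp: Sq_def quasi_prime_def)
    show ?R if ?L
    proof -
      obtain i :: nat where "f [^]\<^bsub>A\<^esub> i \<otimes>\<^bsub>A\<^esub> g [^]\<^bsub>A\<^esub> i \<in> Q"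
        using \<open>?L\<close> distrib by auto
      then have "f [^]\<^bsub>A\<^esub> i \<in> radical A Q \<or> g [^]\<^bsub>A\<^esub> i \<in> radical A Q"
        using qp assms by simp
      then show ?thesis
        using radical_powI[OF assms(1) Q] assms by blast
    qed
    show ?L if ?R
      using that assms ideal.I_l_closed[OF Q] ideal.I_r_closed[OF Q]
      by (metis distrib nat_pow_closed)
  qed
  then show ?thesis
    unfolding Sq_basic_def powers_def by auto
qed

lemma openin_Sq_top:
  assumes "cring A"
  shows "openin (Sq_top A) U \<longleftrightarrow>
    (arbitrary union_of (\<lambda>U. \<exists>f\<in>carrier A. U = Sq_basic A f)) U"
proof -
  interpret cring A by fact
  have "istopology (arbitrary union_of (\<lambda>U. \<exists>f\<in>carrier A. U = Sq_basic A f))"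
    by (rule istopology_base) (use Sq_basic_mult[OF assms] m_closed in blast)
  then show ?thesis
    by (simp add: Sq_top_def topology_inverse')
qed

lemma topspace_Sq_top:
  assumes "cring A"
  shows "topspace (Sq_top A) = Sq A"
proof -
  interpret cring A by fact
  have "\<one>\<^bsub>A\<^esub> \<notin> Q" if "Q \<in> Sq A" for Q
    using that ideal.one_imp_carrier by (auto simp: Sq_def quasi_prime_def)
  then have "Sq_basic A \<one>\<^bsub>A\<^esub> = Sq A"
    by (auto simp: Sq_basic_def powers_def)
  moreover have "openin (Sq_top A) (Sq_basic A \<one>\<^bsub>A\<^esub>)"
    unfolding openin_Sq_top[OF assms] by (rule union_of_inc) (auto simp: arbitrary_def)
  moreover have "U \<subseteq> Sq A" if "openin (Sq_top A) U" for U
    using that unfolding openin_Sq_top[OF assms] union_of_def by (auto simp: Sq_basic_def)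
  ultimately show ?thesis
    by (metis openin_subset openin_topspace subset_antisym)
qed


subsection \<open>The prime spectrum\<close>

definition Spec :: "('a, 'b) ring_scheme \<Rightarrow> 'a set set" where
  "Spec A = {P. primeideal P A}"

definition zero_locus :: "('a, 'b) ring_scheme \<Rightarrow> 'a set \<Rightarrow> 'a set set" where
  "zero_locus A I = {P \<in> Spec A. I \<subseteq> P}"

definition Spec_top :: "('a, 'b) ring_scheme \<Rightarrow> 'a set topology" where
  "Spec_top A = topology (\<lambda>U. \<exists>I. ideal I A \<and> U = Spec A - zero_locus A I)"

lemma zero_locus_Int:
  assumes "ideal I A" "ideal J A"
  shows "zero_locus A (I \<inter> J) = zero_locus A I \<union> zero_locus A J"
proof -
  have "I \<subseteq> P \<or> J \<subseteq> P" if P: "P \<in> Spec A" and IJ: "I \<inter> J \<subseteq> P" for P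
  proof (rule ccontr)
    assume "\<not> (I \<subseteq> P \<or> J \<subseteq> P)"
    then obtain a b where ab: "a \<in> I" "a \<notin> P" "b \<in> J" "b \<notin> P" by blast
    interpret I: ideal I A by fact
    interpret J: ideal J A by fact
    interpret P: primeideal P A using P by (simp add: Spec_def)
    have "a \<in> carrier A" "b \<in> carrier A"
      using ab(1,3) I.Icarr J.Icarr by auto
    moreover from this have "a \<otimes>\<^bsub>A\<^esub> b \<in> P"
      using IJ I.I_r_closed[OF ab(1)] J.I_l_closed[OF ab(3)] by blast
    ultimately show False
      using P.I_prime ab(2,4) by blast
  qed
  then show ?thesis unfolding zero_locus_def by blast
qed

lemma openin_Spec_top:
  assumes "cring A"
  shows "openin (Spec_top A) U \<longleftrightarrow> (\<exists>I. ideal I A \<and> U = Spec A - zero_locus A I)"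
proof -
  interpret cring A by fact
  have "istopology (\<lambda>U. \<exists>I. ideal I A \<and> U = Spec A - zero_locus A I)"
    unfolding istopology_def
  proof (intro conjI allI impI)
    fix S T
    assume "\<exists>I. ideal I A \<and> S = Spec A - zero_locus A I"
      and "\<exists>I. ideal I A \<and> T = Spec A - zero_locus A I"
    then obtain I J where "ideal I A" "ideal J A"
      "S = Spec A - zero_locus A I" "T = Spec A - zero_locus A J" by blast
    then show "\<exists>I. ideal I A \<and> S \<inter> T = Spec A - zero_locus A I"
      using zero_locus_Int i_intersect by (intro exI[of _ "I \<inter> J"]) auto
  next
    fix \<K>
    assume "\<forall>K\<in>\<K>. \<exists>I. ideal I A \<and> K = Spec A - zero_locus A I"
    then obtain I where I: "\<And>K. K \<in> \<K> \<Longrightarrow> ideal (I K) A"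
      "\<And>K. K \<in> \<K> \<Longrightarrow> K = Spec A - zero_locus A (I K)" by metis
    define J where "J = genideal A (\<Union>K\<in>\<K>. I K)"
    have sub: "(\<Union>K\<in>\<K>. I K) \<subseteq> carrier A"
      using I(1) by (meson UN_least additive_subgroup.a_subset ideal.axioms(1))
    have "J \<subseteq> P \<longleftrightarrow> (\<forall>K\<in>\<K>. I K \<subseteq> P)" if "P \<in> Spec A" for P
    proof -
      have "ideal P A" using that by (auto simp: Spec_def primeideal_def)
      then have "J \<subseteq> P \<longleftrightarrow> (\<Union>K\<in>\<K>. I K) \<subseteq> P"
        unfolding J_def using genideal_minimal genideal_self[OF sub] by blast
      then show ?thesis by blast
    qed
    moreover have "K = {P \<in> Spec A. \<not> I K \<subseteq> P}" if "K \<in> \<K>" for K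
      by (subst I(2)[OF that]) (auto simp: zero_locus_def)
    then have "P \<in> \<Union>\<K> \<longleftrightarrow> P \<in> Spec A \<and> \<not> (\<forall>K\<in>\<K>. I K \<subseteq> P)" for P
      by blast
    ultimately have "P \<in> \<Union>\<K> \<longleftrightarrow> P \<in> Spec A - zero_locus A J" for P
      unfolding zero_locus_def by (metis (no_types, lifting) Diff_iff mem_Collect_eq)
    then have "\<Union>\<K> = Spec A - zero_locus A J"
      by (intro Set.set_eqI)
    moreover have "ideal J A"
      unfolding J_def by (rule genideal_ideal[OF sub])
    ultimately show "\<exists>I. ideal I A \<and> \<Union>\<K> = Spec A - zero_locus A I"
      by (intro exI[of _ J]) simp
  qed
  then show ?thesis
    by (simp add: Spec_top_def topology_inverse')
qed

lemma topspace_Spec_top: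
  assumes "cring A"
  shows "topspace (Spec_top A) = Spec A"
proof -
  interpret cring A by fact
  have "\<not> carrier A \<subseteq> P" if "P \<in> Spec A" for P
  proof -
    interpret P: primeideal P A using that by (simp add: Spec_def)
    show ?thesis using P.I_notcarr P.a_subset by blast
  qed
  then have "zero_locus A (carrier A) = {}"
    unfolding zero_locus_def by blast
  then have "openin (Spec_top A) (Spec A)"
    unfolding openin_Spec_top[OF assms] using oneideal by (metis Diff_empty)
  moreover have "U \<subseteq> Spec A" if "openin (Spec_top A) U" for U
    using that unfolding openin_Spec_top[OF assms] by auto
  ultimately show ?thesis
    by (metis openin_subset openin_topspace subset_antisym)
qed


subsection \<open>The space of irreducible closed subsets\<close>

definition irreducible_space :: "'a topology \<Rightarrow> bool" where
  "irreducible_space X \<longleftrightarrow> topspace X \<noteq> {} \<and>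
     \<not> (\<exists>C D. closedin X C \<and> closedin X D \<and> C \<noteq> topspace X \<and> D \<noteq> topspace X \<and>
            topspace X = C \<union> D)"

definition irred_closed :: "'a topology \<Rightarrow> 'a set set" where
  "irred_closed X = {Z. closedin X Z \<and> irreducible_space (subtopology X Z)}"

definition t_space :: "'a topology \<Rightarrow> 'a set topology" where
  "t_space X = topology (\<lambda>U. \<exists>Y. closedin X Y \<and>
     U = irred_closed X - irred_closed (subtopology X Y))"

lemma irred_closed_subtopology:
  assumes "closedin X Y"
  shows "irred_closed (subtopology X Y) = {Z \<in> irred_closed X. Z \<subseteq> Y}"
proof -
  have "subtopology (subtopology X Y) Z = subtopology X Z" if "Z \<subseteq> Y" for Z
    using that by (simp add: subtopology_subtopology Int_absorb1)
  then have "closedin X Z \<and> Z \<subseteq> Y \<and> irreducible_space (subtopology (subtopology X Y) Z)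
      \<longleftrightarrow> closedin X Z \<and> Z \<subseteq> Y \<and> irreducible_space (subtopology X Z)" for Z
    by (metis (no_types))
  then show ?thesis
    by (simp add: irred_closed_def closedin_closed_subtopology[OF assms] conj_ac)
qed

lemma irred_closed_Un:
  assumes "closedin X Y" "closedin X Y'"
  shows "irred_closed (subtopology X (Y \<union> Y')) =
    irred_closed (subtopology X Y) \<union> irred_closed (subtopology X Y')"
proof -
  have "Z \<subseteq> Y \<or> Z \<subseteq> Y'" if Z: "Z \<in> irred_closed X" and sub: "Z \<subseteq> Y \<union> Y'" for Z
  proof -
    have cl: "closedin X Z" and irr: "irreducible_space (subtopology X Z)"
      using Z by (auto simp: irred_closed_def)
    have top: "topspace (subtopology X Z) = Z"
      using closedin_subset[OF cl] by auto
    have "closedin (subtopology X Z) (Z \<inter> Y)" "closedin (subtopology X Z) (Z \<inter> Y')"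
      using assms cl by (auto simp: closedin_closed_subtopology)
    moreover have "Z = (Z \<inter> Y) \<union> (Z \<inter> Y')" using sub by blast
    ultimately have "Z \<inter> Y = Z \<or> Z \<inter> Y' = Z"
      using irr unfolding irreducible_space_def top by blast
    then show ?thesis by blast
  qed
  then show ?thesis
    using irred_closed_subtopology[OF assms(1)] irred_closed_subtopology[OF assms(2)]
      irred_closed_subtopology[OF closedin_Un[OF assms]] by auto
qed

lemma openin_t_space:
  "openin (t_space X) U \<longleftrightarrow>
     (\<exists>Y. closedin X Y \<and> U = irred_closed X - irred_closed (subtopology X Y))"
proof -
  have "istopology (\<lambda>U. \<exists>Y. closedin X Y \<and>
          U = irred_closed X - irred_closed (subtopology X Y))"
    unfolding istopology_def
  proof (intro conjI allI impI)
    fix S T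
    assume "\<exists>Y. closedin X Y \<and> S = irred_closed X - irred_closed (subtopology X Y)"
      and "\<exists>Y. closedin X Y \<and> T = irred_closed X - irred_closed (subtopology X Y)"
    then obtain Y Y' where "closedin X Y" "closedin X Y'"
      "S = irred_closed X - irred_closed (subtopology X Y)"
      "T = irred_closed X - irred_closed (subtopology X Y')" by blast
    then show "\<exists>Y. closedin X Y \<and> S \<inter> T = irred_closed X - irred_closed (subtopology X Y)"
      using irred_closed_Un by (intro exI[of _ "Y \<union> Y'"]) auto
  next
    fix \<K>
    assume "\<forall>K\<in>\<K>. \<exists>Y. closedin X Y \<and> K = irred_closed X - irred_closed (subtopology X Y)"
    then obtain Y where Y: "\<And>K. K \<in> \<K> \<Longrightarrow> closedin X (Y K)"
      "\<And>K. K \<in> \<K> \<Longrightarrow> K = irred_closed X - irred_closed (subtopology X (Y K))" by metis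
    define W where "W = topspace X \<inter> (\<Inter>K\<in>\<K>. Y K)"
    have W: "closedin X W"
      using Y(1) unfolding W_def by (cases "\<K> = {}") auto
    have eq: "K = {Z \<in> irred_closed X. \<not> Z \<subseteq> Y K}" if "K \<in> \<K>" for K
      using Y[OF that] irred_closed_subtopology by blast
    have "Z \<subseteq> topspace X" if "Z \<in> irred_closed X" for Z
      using that closedin_subset by (auto simp: irred_closed_def)
    then have "Z \<subseteq> W \<longleftrightarrow> (\<forall>K\<in>\<K>. Z \<subseteq> Y K)" if "Z \<in> irred_closed X" for Z
      using that unfolding W_def by blast
    moreover have "Z \<in> \<Union>\<K> \<longleftrightarrow> Z \<in> irred_closed X \<and> \<not> (\<forall>K\<in>\<K>. Z \<subseteq> Y K)" for Z
      using eq by (metis (no_types, lifting) Union_iff mem_Collect_eq)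
    ultimately have "Z \<in> \<Union>\<K> \<longleftrightarrow> Z \<in> irred_closed X - irred_closed (subtopology X W)" for Z
      by (metis (no_types, lifting) irred_closed_subtopology[OF W] Diff_iff mem_Collect_eq)
    then have "\<Union>\<K> = irred_closed X - irred_closed (subtopology X W)"
      by (intro Set.set_eqI)
    then show "\<exists>Y. closedin X Y \<and> \<Union>\<K> = irred_closed X - irred_closed (subtopology X Y)"
      using W by blast
  qed
  then show ?thesis
    by (simp add: t_space_def topology_inverse')
qed

lemma topspace_t_space: "topspace (t_space X) = irred_closed X"
proof -
  have "irred_closed (subtopology X {}) = {}"
    by (auto simp: irred_closed_subtopology irred_closed_def irreducible_space_def)
  then have "openin (t_space X) (irred_closed X)"
    unfolding openin_t_space by (metis Diff_empty closedin_empty)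
  moreover have "U \<subseteq> irred_closed X" if "openin (t_space X) U" for U
    using that unfolding openin_t_space by auto
  ultimately show ?thesis
    by (metis openin_subset openin_topspace subset_antisym)
qed

lemma closedin_t_space:
  "closedin (t_space X) C \<longleftrightarrow>
     (\<exists>Y. closedin X Y \<and> C = irred_closed (subtopology X Y))"
proof -
  have "irred_closed (subtopology X Y) \<subseteq> irred_closed X" if "closedin X Y" for Y
    using irred_closed_subtopology[OF that] by blast
  then show ?thesis
    unfolding closedin_def topspace_t_space openin_t_space
    by (metis (no_types, lifting) Diff_subset double_diff order_refl)
qed

end

theory Submission
  imports Defs
begin

text \<open>
  Everything rests on the map \<open>Q \<mapsto> \<surd>Q\<close>. The radical of a quasi-prime ideal is prime, and a
  quasi-prime ideal \<open>Q\<close> lies in \<open>U\<^sub>f\<close> exactly when \<open>f \<notin> \<surd>Q\<close>; hence the closed subsets of \<open>Sq A\<close> are the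
  sets \<open>{Q. F \<subseteq> \<surd>Q}\<close>, which are the preimages of the closed subsets of \<open>Spec A\<close>
  (\<open>closedin_Sq_top\<close>, \<open>closedin_Spec_top\<close>). As primes are quasi-prime and equal to their own radical,
  every point \<open>Q\<close> of \<open>Sq A\<close> is topologically indistinguishable from the point \<open>\<surd>Q\<close> of \<open>Spec A\<close>.

  Since \<open>Spec A\<close> is sober, passing to irreducible closed subsets yields \<open>Spec A\<close>. Concretely, the generic
  point of an irreducible closed set \<open>Z\<close> of \<open>Sq A\<close> is the ideal \<open>\<Inter>Q\<in>Z. \<surd>Q\<close> of functions that vanish on
  \<open>Z\<close>: irreducibility makes it prime, and \<open>Z\<close> is its closure (\<open>irred_closed_eq_closure\<close>). Conversely the
  ideal vanishing on the closure of \<open>Q\<close> is \<open>\<surd>Q\<close>. These two assignments are mutually inverse, and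
  they match the closed sets on both sides, because the ideal of \<open>Z\<close> contains \<open>F\<close> exactly when
  \<open>Z \<subseteq> {Q. F \<subseteq> \<surd>Q}\<close>.
\<close>

section \<open>Radicals of quasi-prime ideals\<close>

lemma radical_subset_carrier: "radical A I \<subseteq> carrier A"
  by (auto simp: radical_def)

lemma subset_radical:
  assumes "ideal I A"
  shows "I \<subseteq> radical A I"
proof -
  interpret ideal I A by fact
  have "x [^]\<^bsub>A\<^esub> (1::nat) \<in> I" if "x \<in> I" for x
    using that Icarr by simp
  then show ?thesis
    unfolding radical_def using Icarr by (blast intro: zero_less_one)
qed

context cring
begin

lemma ideal_nat_pow_mono:
  assumes "ideal I R" "x \<in> carrier R" "x [^] (n::nat) \<in> I" "n \<le> m"
  shows "x [^] m \<in> I"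
proof -
  have "x [^] m = x [^] n \<otimes> x [^] (m - n)"
    using assms by (simp add: nat_pow_mult)
  then show ?thesis
    using assms ideal.I_r_closed by fastforce
qed

text \<open>Replaces the binomial theorem in showing that a sum of nilpotents modulo \<open>I\<close> is nilpotent: each
  factor \<open>f \<oplus> g\<close> is traded for one factor \<open>f\<close> or one factor \<open>g\<close>, until pigeonhole applies.\<close>

lemma pow_add_mult_in_ideal:
  assumes I: "ideal I R" and f: "f \<in> carrier R" "f [^] (n::nat) \<in> I"
    and g: "g \<in> carrier R" "g [^] (m::nat) \<in> I"
  shows "n + m \<le> k + i + j \<Longrightarrow> (f \<oplus> g) [^] (k::nat) \<otimes> (f [^] (i::nat) \<otimes> g [^] (j::nat)) \<in> I"
proof (induction k arbitrary: i j)
  case 0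
  then have "n \<le> i \<or> m \<le> j" by linarith
  then have "f [^] i \<in> I \<or> g [^] j \<in> I"
    using ideal_nat_pow_mono[OF I f] ideal_nat_pow_mono[OF I g] by blast
  then have "f [^] i \<otimes> g [^] j \<in> I"
    using ideal.I_l_closed[OF I] ideal.I_r_closed[OF I] f g by auto
  then show ?case
    using f g by simp
next
  case (Suc k)
  let ?p = "(f \<oplus> g) [^] k"
  have "?p \<otimes> (f [^] Suc i \<otimes> g [^] j) \<oplus> ?p \<otimes> (f [^] i \<otimes> g [^] Suc j) \<in> I"
    using Suc.IH[of "Suc i" j] Suc.IH[of i "Suc j"] Suc.prems
      additive_subgroup.a_closed[OF ideal.axioms(1)[OF I]] by simp
  moreover have "?p \<otimes> (f \<oplus> g) \<otimes> (x \<otimes> y) = ?p \<otimes> (x \<otimes> f \<otimes> y) \<oplus> ?p \<otimes> (x \<otimes> (y \<otimes> g))"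
    if "x \<in> carrier R" "y \<in> carrier R" for x y
    using that f(1) g(1) by (simp add: l_distr r_distr m_ac)
  ultimately show ?case
    using f g by simp
qed

lemma ideal_radical:
  assumes I: "ideal I R"
  shows "ideal (radical R I) R"
proof -
  interpret I: ideal I R by fact
  have add: "f \<oplus> g \<in> radical R I" if "f \<in> radical R I" "g \<in> radical R I" for f g
  proof -
    obtain n m :: nat where nm: "n > 0" "f [^] n \<in> I" "g [^] m \<in> I"
      and fg: "f \<in> carrier R" "g \<in> carrier R"
      using \<open>f \<in> radical R I\<close> \<open>g \<in> radical R I\<close> by (auto simp: radical_def)
    have "(f \<oplus> g) [^] (n + m) \<otimes> (f [^] (0::nat) \<otimes> g [^] (0::nat)) \<in> I"
      by (rule pow_add_mult_in_ideal[OF I fg(1) nm(2) fg(2) nm(3)]) simp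
    then have "(f \<oplus> g) [^] (n + m) \<in> I"
      using fg by simp
    moreover have "n + m > 0" using nm by simp
    ultimately show ?thesis
      using fg unfolding radical_def by blast
  qed
  have mult: "x \<otimes> f \<in> radical R I" if "f \<in> radical R I" "x \<in> carrier R" for f x
  proof -
    obtain n :: nat where n: "n > 0" "f [^] n \<in> I" and f: "f \<in> carrier R"
      using \<open>f \<in> radical R I\<close> by (auto simp: radical_def)
    have "(x \<otimes> f) [^] n \<in> I"
      using n f \<open>x \<in> carrier R\<close> I.I_l_closed by (simp add: nat_pow_distrib)
    then show ?thesis
      using n f \<open>x \<in> carrier R\<close> unfolding radical_def by blast
  qed
  have car: "f \<in> carrier R" if "f \<in> radical R I" for f
    using that by (rule subsetD[OF radical_subset_carrier])
  show ?thesis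
  proof (rule idealI)
    show "ring R" by (rule ring_axioms)
    show "subgroup (radical R I) (add_monoid R)"
    proof (rule add.subgroupI)
      show "radical R I \<subseteq> carrier R" by (rule radical_subset_carrier)
      show "radical R I \<noteq> {}"
        using subset_radical[OF I] I.zero_closed by blast
      show "\<ominus> f \<in> radical R I" if "f \<in> radical R I" for f
        using mult[OF that, of "\<ominus> \<one>"] car[OF that] by (simp add: l_minus)
    qed (rule add)
    show "x \<otimes> f \<in> radical R I" if "f \<in> radical R I" "x \<in> carrier R" for f x
      by (rule mult[OF that])
    show "f \<otimes> x \<in> radical R I" if "f \<in> radical R I" "x \<in> carrier R" for f x
      using mult[OF that] car[OF that(1)] that(2) by (simp add: m_comm)
  qed
qed

lemma radical_radical_subset: "radical R (radical R I) \<subseteq> radical R I"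
proof
  fix f assume "f \<in> radical R (radical R I)"
  then obtain n m :: nat where "n > 0" "m > 0" and f: "f \<in> carrier R" and "(f [^] n) [^] m \<in> I"
    by (auto simp: radical_def)
  then have "n * m > 0" "f [^] (n * m) \<in> I"
    by (auto simp: nat_pow_pow)
  then show "f \<in> radical R I"
    using f unfolding radical_def by blast
qed

lemma radical_primeideal:
  assumes "primeideal P R"
  shows "radical R P = P"
proof
  interpret P: primeideal P R by fact
  have "f \<in> P" if "f \<in> carrier R" "f [^] (n::nat) \<in> P" for f n
    using that(2)
  proof (induction n)
    case 0
    then show ?case using P.one_imp_carrier P.I_notcarr by simp
  next
    case (Suc n)
    then show ?case using P.I_prime[of "f [^] n" f] that(1) by auto
  qed
  then show "radical R P \<subseteq> P"
    by (auto simp: radical_def)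
  show "P \<subseteq> radical R P"
    by (rule subset_radical[OF P.is_ideal])
qed

lemma primeideal_radical:
  assumes "quasi_prime Q R"
  shows "primeideal (radical R Q) R"
proof (rule primeidealI)
  have Q: "ideal Q R" and proper: "\<one> \<notin> Q" and
    qp: "\<And>f g. \<lbrakk>f \<in> carrier R; g \<in> carrier R; f \<otimes> g \<in> Q\<rbrakk> \<Longrightarrow> f \<in> radical R Q \<or> g \<in> radical R Q"
    using assms ideal.one_imp_carrier by (auto simp: quasi_prime_def)
  show "ideal (radical R Q) R"
    by (rule ideal_radical[OF Q])
  show "cring R" by (rule cring_axioms)
  have "\<one> \<notin> radical R Q"
    using proper by (auto simp: radical_def)
  then show "carrier R \<noteq> radical R Q"
    by auto
  fix f g
  assume f: "f \<in> carrier R" and g: "g \<in> carrier R" and "f \<otimes> g \<in> radical R Q"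
  then obtain n :: nat where n: "n > 0" "f [^] n \<otimes> g [^] n \<in> Q"
    by (auto simp: radical_def nat_pow_distrib)
  then have "f [^] n \<in> radical R Q \<or> g [^] n \<in> radical R Q"
    using qp f g by simp
  then have "f \<in> radical R (radical R Q) \<or> g \<in> radical R (radical R Q)"
    using f g n(1) unfolding radical_def[of R "radical R Q"] by blast
  then show "f \<in> radical R Q \<or> g \<in> radical R Q"
    using radical_radical_subset by blast
qed

lemma radical_in_Spec: "Q \<in> Sq R \<Longrightarrow> radical R Q \<in> Spec R"
  by (simp add: Sq_def Spec_def primeideal_radical)

lemma Spec_subset_Sq: "Spec R \<subseteq> Sq R"
proof
  fix P assume "P \<in> Spec R"
  then interpret P: primeideal P R by (simp add: Spec_def)
  show "P \<in> Sq R"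
    unfolding Sq_def quasi_prime_def
    using P.is_ideal P.I_notcarr P.I_prime radical_primeideal[OF P.primeideal_axioms] by auto
qed

lemma radical_Spec: "P \<in> Spec R \<Longrightarrow> radical R P = P"
  by (simp add: Spec_def radical_primeideal)

section \<open>Closed sets of the two spectra\<close>

text \<open>The zeroth power, present in \<open>powers\<close> but not in \<open>radical\<close>, makes no difference because a
  quasi-prime ideal is proper.\<close>

lemma Sq_basic_eq:
  assumes "f \<in> carrier R"
  shows "Sq_basic R f = {Q \<in> Sq R. f \<notin> radical R Q}"
proof -
  have "Q \<inter> powers R f = {} \<longleftrightarrow> f \<notin> radical R Q" if "Q \<in> Sq R" for Q
  proof -
    have Q: "ideal Q R" and proper: "\<one> \<notin> Q"
      using that ideal.one_imp_carrier by (auto simp: Sq_def quasi_prime_def)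
    have "(\<exists>n::nat. f [^] n \<in> Q) \<longleftrightarrow> (\<exists>n::nat>0. f [^] n \<in> Q)"
      using proper by (metis gr0I nat_pow_0)
    then show ?thesis
      using assms unfolding powers_def radical_def by blast
  qed
  then show ?thesis
    by (auto simp: Sq_basic_def)
qed

end

definition Sq_zero_locus :: "('a, 'b) ring_scheme \<Rightarrow> 'a set \<Rightarrow> 'a set set" where
  "Sq_zero_locus A F = {Q \<in> Sq A. F \<subseteq> radical A Q}"

lemma closedin_Sq_top:
  assumes "cring A"
  shows "closedin (Sq_top A) C \<longleftrightarrow> (\<exists>F\<subseteq>carrier A. C = Sq_zero_locus A F)"
proof
  interpret cring A by fact
  have compl: "Sq A - \<Union>(Sq_basic A ` F) = Sq_zero_locus A F" if "F \<subseteq> carrier A" for F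
  proof -
    have "\<Union>(Sq_basic A ` F) = (\<Union>f\<in>F. {Q \<in> Sq A. f \<notin> radical A Q})"
      using that Sq_basic_eq by blast
    then show ?thesis
      by (auto simp: Sq_zero_locus_def)
  qed
  show "\<exists>F\<subseteq>carrier A. C = Sq_zero_locus A F" if C: "closedin (Sq_top A) C"
  proof -
    have "C \<subseteq> Sq A" and "openin (Sq_top A) (Sq A - C)"
      using C by (auto simp: closedin_def topspace_Sq_top[OF assms])
    then have "\<exists>\<U>. \<U> \<subseteq> {U. \<exists>f\<in>carrier A. U = Sq_basic A f} \<and> \<Union>\<U> = Sq A - C"
      by (simp add: openin_Sq_top[OF assms] union_of_def arbitrary_def)
    then obtain \<U> where \<U>: "\<U> \<subseteq> {U. \<exists>f\<in>carrier A. U = Sq_basic A f}" "\<Union>\<U> = Sq A - C"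
      by (elim exE conjE)
    define F where "F = {f \<in> carrier A. Sq_basic A f \<in> \<U>}"
    have F: "F \<subseteq> carrier A" "Sq_basic A ` F = \<U>"
      unfolding F_def using \<U>(1) by blast+
    have "Sq_zero_locus A F = Sq A - (Sq A - C)"
      using compl[OF F(1)] F(2) \<U>(2) by simp
    then have "C = Sq_zero_locus A F"
      using double_diff[OF \<open>C \<subseteq> Sq A\<close> order_refl] by simp
    then show ?thesis
      using F(1) by (intro exI[of _ F] conjI)
  qed
  show "closedin (Sq_top A) C" if ex: "\<exists>F\<subseteq>carrier A. C = Sq_zero_locus A F"
  proof -
    obtain F where F: "F \<subseteq> carrier A" "C = Sq_zero_locus A F"
      using ex by blast
    have "openin (Sq_top A) (\<Union>(Sq_basic A ` F))"
    proof (rule openin_Union)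
      fix U assume "U \<in> Sq_basic A ` F"
      then show "openin (Sq_top A) U"
        unfolding openin_Sq_top[OF assms] using F(1)
        by (intro union_of_inc) (auto simp: arbitrary_def)
    qed
    then have "closedin (Sq_top A) (topspace (Sq_top A) - \<Union>(Sq_basic A ` F))"
      by (rule closedin_diff[OF closedin_topspace])
    then show ?thesis
      using compl[OF F(1)] F(2) topspace_Sq_top[OF assms] by simp
  qed
qed

text \<open>Arbitrary subsets may replace ideals, since a set and the ideal that it generates have the same
  zero locus. This brings the closed sets into the form that they have on \<open>Sq A\<close>.\<close>

lemma closedin_Spec_top:
  assumes "cring A"
  shows "closedin (Spec_top A) C \<longleftrightarrow> (\<exists>F\<subseteq>carrier A. C = zero_locus A F)"
proof -
  interpret cring A by fact
  have gen: "zero_locus A (genideal A F) = zero_locus A F" if F: "F \<subseteq> carrier A" for F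
  proof -
    have "genideal A F \<subseteq> P \<longleftrightarrow> F \<subseteq> P" if "P \<in> Spec A" for P
    proof -
      have "ideal P A" using that by (auto simp: Spec_def primeideal_def)
      then show ?thesis using genideal_minimal genideal_self[OF F] by blast
    qed
    then show ?thesis by (auto simp: zero_locus_def)
  qed
  have "closedin (Spec_top A) C \<longleftrightarrow> (\<exists>I. ideal I A \<and> C = zero_locus A I)"
  proof -
    have "zero_locus A I \<subseteq> Spec A" for I by (auto simp: zero_locus_def)
    then show ?thesis
      unfolding closedin_def topspace_Spec_top[OF assms] openin_Spec_top[OF assms]
      by (metis Diff_subset double_diff order_refl)
  qed
  also have "\<dots> \<longleftrightarrow> (\<exists>F\<subseteq>carrier A. C = zero_locus A F)"
    using gen genideal_ideal by (metis additive_subgroup.a_subset ideal.axioms(1))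
  finally show ?thesis .
qed

lemma closure_of_singleton_Sq:
  assumes "cring A" "Q \<in> Sq A"
  shows "Sq_top A closure_of {Q} = Sq_zero_locus A (radical A Q)"
proof (rule closure_of_unique)
  show "{Q} \<subseteq> Sq_zero_locus A (radical A Q)"
    using assms(2) by (simp add: Sq_zero_locus_def)
  show "closedin (Sq_top A) (Sq_zero_locus A (radical A Q))"
    unfolding closedin_Sq_top[OF assms(1)]
    by (intro exI[of _ "radical A Q"] conjI radical_subset_carrier refl)
next
  fix T assume "{Q} \<subseteq> T" "closedin (Sq_top A) T"
  then obtain F where "T = Sq_zero_locus A F" "Q \<in> Sq_zero_locus A F"
    unfolding closedin_Sq_top[OF assms(1)] by (elim exE conjE) simp
  then show "Sq_zero_locus A (radical A Q) \<subseteq> T"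
    by (auto simp: Sq_zero_locus_def)
qed

section \<open>Generic points of irreducible closed sets\<close>

lemma irred_closedD:
  assumes "Z \<in> irred_closed X" "closedin X C" "closedin X D" "Z \<subseteq> C \<union> D"
  shows "Z \<subseteq> C \<or> Z \<subseteq> D"
proof -
  have "Z \<in> irred_closed (subtopology X (C \<union> D))"
    using assms(1,4) irred_closed_subtopology[OF closedin_Un[OF assms(2,3)]] by simp
  then show ?thesis
    unfolding irred_closed_Un[OF assms(2,3)]
    using irred_closed_subtopology[OF assms(2)] irred_closed_subtopology[OF assms(3)] by blast
qed

lemma irred_closed_nonempty: "Z \<in> irred_closed X \<Longrightarrow> Z \<noteq> {}"
  by (auto simp: irred_closed_def irreducible_space_def)

lemma closure_of_singleton_irred_closed:
  assumes "x \<in> topspace X"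
  shows "X closure_of {x} \<in> irred_closed X"
proof -
  let ?Z = "X closure_of {x}"
  have cl: "closedin X ?Z" by simp
  have x: "x \<in> ?Z"
    using closure_of_subset[of "{x}" X] assms by simp
  have top: "topspace (subtopology X ?Z) = ?Z"
    using closure_of_subset_topspace[of X "{x}"] by auto
  have "C = ?Z" if "closedin (subtopology X ?Z) C" "x \<in> C" for C
  proof -
    have "closedin X C" "C \<subseteq> ?Z"
      using that(1) closedin_closed_subtopology[OF cl] by auto
    then show ?thesis
      using that(2) closure_of_minimal[of "{x}" C X] by blast
  qed
  then have "irreducible_space (subtopology X ?Z)"
    unfolding irreducible_space_def top using x by blast
  then show ?thesis
    using cl by (simp add: irred_closed_def)
qed

definition vanishing_ideal :: "('a, 'b) ring_scheme \<Rightarrow> 'a set set \<Rightarrow> 'a set" where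
  "vanishing_ideal A Z = (\<Inter>Q\<in>Z. radical A Q)"

text \<open>The Galois connection between subsets of \<open>A\<close> and subsets of \<open>Sq A\<close>.\<close>

lemma subset_vanishing_ideal_iff:
  assumes "Z \<subseteq> Sq A"
  shows "F \<subseteq> vanishing_ideal A Z \<longleftrightarrow> Z \<subseteq> Sq_zero_locus A F"
  using assms by (auto simp: vanishing_ideal_def Sq_zero_locus_def)

lemma vanishing_ideal_closure_of_singleton:
  assumes "cring A" "Q \<in> Sq A"
  shows "vanishing_ideal A (Sq_top A closure_of {Q}) = radical A Q"
  using assms(2)
  by (auto simp: closure_of_singleton_Sq[OF assms] vanishing_ideal_def Sq_zero_locus_def)

lemma irred_closed_Sq_subset:
  assumes "cring A" "Z \<in> irred_closed (Sq_top A)"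
  shows "Z \<subseteq> Sq A"
  using assms(2) closedin_subset[of "Sq_top A" Z]
  by (simp add: irred_closed_def topspace_Sq_top[OF assms(1)])

text \<open>If \<open>f \<otimes> g\<close> vanishes on \<open>Z\<close>, then \<open>Z\<close> is covered by the closed sets \<open>f = 0\<close> and \<open>g = 0\<close>, hence
  contained in one of them. Properness comes from \<open>Z \<noteq> {}\<close>.\<close>

lemma vanishing_ideal_in_Spec:
  assumes "cring A" "Z \<in> irred_closed (Sq_top A)"
  shows "vanishing_ideal A Z \<in> Spec A"
proof -
  interpret cring A by fact
  have Z: "Z \<subseteq> Sq A" "Z \<noteq> {}"
    using irred_closed_Sq_subset[OF assms] irred_closed_nonempty[OF assms(2)] by auto
  have prime: "primeideal (radical A Q) A" if "Q \<in> Z" for Q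
    using that Z(1) radical_in_Spec by (auto simp: Spec_def)
  have "primeideal (vanishing_ideal A Z) A"
  proof (rule primeidealI)
    show "cring A" by fact
    have "ideal (\<Inter>(radical A ` Z)) A"
      using prime Z(2) by (intro i_Intersect) (auto simp: primeideal_def)
    then show "ideal (vanishing_ideal A Z) A"
      by (simp add: vanishing_ideal_def)
    obtain Q where "Q \<in> Z" using Z(2) by blast
    then have "vanishing_ideal A Z \<subseteq> radical A Q" "radical A Q \<noteq> carrier A"
      using primeideal.I_notcarr[OF prime] by (auto simp: vanishing_ideal_def)
    then show "carrier A \<noteq> vanishing_ideal A Z"
      using radical_subset_carrier[of A Q] by blast
    fix f g
    assume f: "f \<in> carrier A" and g: "g \<in> carrier A" and "f \<otimes>\<^bsub>A\<^esub> g \<in> vanishing_ideal A Z"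
    then have "f \<in> radical A Q \<or> g \<in> radical A Q" if "Q \<in> Z" for Q
      using that primeideal.I_prime[OF prime] by (auto simp: vanishing_ideal_def)
    then have "Z \<subseteq> Sq_zero_locus A {f} \<union> Sq_zero_locus A {g}"
      using Z(1) by (auto simp: Sq_zero_locus_def)
    moreover have "closedin (Sq_top A) (Sq_zero_locus A {f})"
      "closedin (Sq_top A) (Sq_zero_locus A {g})"
      unfolding closedin_Sq_top[OF assms(1)] using f g by blast+
    ultimately have "Z \<subseteq> Sq_zero_locus A {f} \<or> Z \<subseteq> Sq_zero_locus A {g}"
      using irred_closedD[OF assms(2)] by blast
    then show "f \<in> vanishing_ideal A Z \<or> g \<in> vanishing_ideal A Z"
      using subset_vanishing_ideal_iff[OF Z(1)] by (metis insert_subset)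
  qed
  then show ?thesis by (simp add: Spec_def)
qed

text \<open>Write \<open>Z\<close> as the zero locus of \<open>F\<close>. The vanishing ideal contains \<open>F\<close> and is its own radical, so it
  is a point of \<open>Z\<close>; being contained in the radical of every point of \<open>Z\<close>, it is generic.\<close>

lemma irred_closed_eq_closure:
  assumes "cring A" "Z \<in> irred_closed (Sq_top A)"
  shows "Sq_top A closure_of {vanishing_ideal A Z} = Z"
proof -
  interpret cring A by fact
  let ?P = "vanishing_ideal A Z"
  have P: "?P \<in> Spec A" "?P \<in> Sq A" and rad: "radical A ?P = ?P"
    using vanishing_ideal_in_Spec[OF assms] Spec_subset_Sq radical_Spec by auto
  have Z: "Z \<subseteq> Sq A"
    by (rule irred_closed_Sq_subset[OF assms])
  obtain F where F: "Z = Sq_zero_locus A F"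
    using assms(2) closedin_Sq_top[OF assms(1)] by (auto simp: irred_closed_def)
  have "F \<subseteq> ?P"
    using subset_vanishing_ideal_iff[OF Z] F by blast
  then have "Sq_zero_locus A ?P \<subseteq> Z"
    unfolding F by (auto simp: Sq_zero_locus_def)
  moreover have "Z \<subseteq> Sq_zero_locus A ?P"
    using subset_vanishing_ideal_iff[OF Z] by blast
  ultimately show ?thesis
    using closure_of_singleton_Sq[OF assms(1) P(2)] rad by simp
qed

section \<open>The homeomorphism\<close>

lemma continuous_map_vanishing_ideal:
  assumes "cring A"
  shows "continuous_map (t_space (Sq_top A)) (Spec_top A) (vanishing_ideal A)"
  unfolding continuous_map_closedin topspace_t_space topspace_Spec_top[OF assms]
proof (intro conjI ballI allI impI)
  show "vanishing_ideal A \<in> irred_closed (Sq_top A) \<rightarrow> Spec A"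
    using vanishing_ideal_in_Spec[OF assms] by blast
  fix C assume "closedin (Spec_top A) C"
  then obtain F where F: "F \<subseteq> carrier A" "C = zero_locus A F"
    unfolding closedin_Spec_top[OF assms] by blast
  have cl: "closedin (Sq_top A) (Sq_zero_locus A F)"
    unfolding closedin_Sq_top[OF assms] using F(1) by blast
  have "vanishing_ideal A Z \<in> C \<longleftrightarrow> Z \<subseteq> Sq_zero_locus A F" if "Z \<in> irred_closed (Sq_top A)" for Z
    using vanishing_ideal_in_Spec[OF assms that]
      subset_vanishing_ideal_iff[OF irred_closed_Sq_subset[OF assms that]]
    by (simp add: F(2) zero_locus_def)
  then have "{Z \<in> irred_closed (Sq_top A). vanishing_ideal A Z \<in> C}
      = irred_closed (subtopology (Sq_top A) (Sq_zero_locus A F))"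
    unfolding irred_closed_subtopology[OF cl] by blast
  then show "closedin (t_space (Sq_top A)) {Z \<in> irred_closed (Sq_top A). vanishing_ideal A Z \<in> C}"
    unfolding closedin_t_space using cl by blast
qed

lemma continuous_map_closure_of_singleton:
  assumes "cring A"
  shows "continuous_map (Spec_top A) (t_space (Sq_top A)) (\<lambda>P. Sq_top A closure_of {P})"
  unfolding continuous_map_closedin topspace_t_space topspace_Spec_top[OF assms]
proof (intro conjI ballI allI impI)
  interpret cring A by fact
  have irr: "Sq_top A closure_of {P} \<in> irred_closed (Sq_top A)" if "P \<in> Spec A" for P
    using that Spec_subset_Sq topspace_Sq_top[OF assms]
    by (intro closure_of_singleton_irred_closed) auto
  then show "(\<lambda>P. Sq_top A closure_of {P}) \<in> Spec A \<rightarrow> irred_closed (Sq_top A)"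
    by blast
  fix C assume "closedin (t_space (Sq_top A)) C"
  then obtain Y where Y: "closedin (Sq_top A) Y" "C = irred_closed (subtopology (Sq_top A) Y)"
    unfolding closedin_t_space by blast
  then obtain F where F: "F \<subseteq> carrier A" "Y = Sq_zero_locus A F"
    unfolding closedin_Sq_top[OF assms] by blast
  have "Sq_top A closure_of {P} \<in> C \<longleftrightarrow> P \<in> zero_locus A F" if P: "P \<in> Spec A" for P
  proof -
    have Q: "P \<in> Sq A" using P Spec_subset_Sq by blast
    have "Sq_top A closure_of {P} \<in> C \<longleftrightarrow> Sq_top A closure_of {P} \<subseteq> Sq_zero_locus A F"
      using irr[OF P] irred_closed_subtopology[OF Y(1)] by (simp add: Y(2) F(2))
    also have "\<dots> \<longleftrightarrow> F \<subseteq> vanishing_ideal A (Sq_top A closure_of {P})"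
      using subset_vanishing_ideal_iff[OF irred_closed_Sq_subset[OF assms irr[OF P]]] by blast
    also have "\<dots> \<longleftrightarrow> P \<in> zero_locus A F"
      using P by (simp add: vanishing_ideal_closure_of_singleton[OF assms Q] radical_Spec
          zero_locus_def)
    finally show ?thesis .
  qed
  then have "{P \<in> Spec A. Sq_top A closure_of {P} \<in> C} = zero_locus A F"
    by (auto simp: zero_locus_def)
  then show "closedin (Spec_top A) {P \<in> Spec A. Sq_top A closure_of {P} \<in> C}"
    unfolding closedin_Spec_top[OF assms] using F(1) by blast
qed

theorem theorem4p1:
  fixes A :: "('a, 'b) ring_scheme"
  assumes "cring A"
  shows "\<exists>h. homeomorphic_maps (t_space (Sq_top A)) (Spec_top A)
               h (\<lambda>P. Sq_top A closure_of {P}) \<and>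
             (\<forall>Q\<in>Sq A. h (Sq_top A closure_of {Q}) = radical A Q)"
proof (intro exI conjI ballI)
  interpret cring A by fact
  have "vanishing_ideal A (Sq_top A closure_of {P}) = P" if "P \<in> Spec A" for P
    using that Spec_subset_Sq vanishing_ideal_closure_of_singleton[OF assms] radical_Spec by auto
  then show "homeomorphic_maps (t_space (Sq_top A)) (Spec_top A)
      (vanishing_ideal A) (\<lambda>P. Sq_top A closure_of {P})"
    using continuous_map_vanishing_ideal[OF assms] continuous_map_closure_of_singleton[OF assms]
      irred_closed_eq_closure[OF assms]
    by (simp add: homeomorphic_maps_def topspace_t_space topspace_Spec_top[OF assms])
  show "vanishing_ideal A (Sq_top A closure_of {Q}) = radical A Q" if "Q \<in> Sq A" for Q
    by (rule vanishing_ideal_closure_of_singleton[OF assms that])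
qed

end
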